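(* For any dataset $(\mathbf{X},y)$ it holds that $\mathrm{DegSEP}^* = \mathrm{PertNSEP}^*$.
   Context: A dataset $(\mathbf{X},y)$ consists of a matrix $\mathbf{X}\in\mathbb{R}^{n\times p}$ whose $i$-th row is $\mathbf{x}_i$ ($\mathbf{x}_i\in\mathbb{R}^p$), and $y\in\{-1,1\}^n$. The dataset is separable if there exists $\beta\in\mathbb{R}^p$ with $y_i\beta^T\mathbf{x}_i>0$ for all $i=1,\ldots,n$, and non-separable otherwise. Let $\|\cdot\|$ be a given (arbitrary) norm on $\mathbb{R}^p$, and for $A\in\mathbb{R}^{n\times p}$ let $\|A\|_{\cdot,\infty} := \max_{\|\beta\|\le 1}\|A\beta\|_\infty$. The margin of $\beta$ is $\rho(\beta):=\min_{i\in\{1,\ldots,n\}} y_i\beta^T\mathbf{x}_i$. Define $$\mathrm{DegSEP}^* := \max_{\beta:\ \|\beta\|\le 1}\ \rho(\beta),$$ $$\mathrm{PertNSEP}^* := \inf\Big\{\|\Delta\mathbf{X}\|_{\cdot,\infty} \ :\ \Delta\mathbf{X}\in\mathbb{R}^{n\times p},\ (\mathbf{X}+\Delta\mathbf{X},y)\text{ is non-separable}\Big\}.$$ *)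

theory Defs
  imports "HOL-Analysis.Analysis"
begin

text \<open>
  A dataset is a matrix \<open>X :: real ^ 'p ^ 'n\<close> with rows \<open>X $ i\<close>, together with labels
  \<open>y :: real ^ 'n\<close>. The norm on \<open>real ^ 'p\<close> is an arbitrary function \<open>N\<close> satisfying the norm
  axioms, since the type class instance \<open>norm\<close> only provides the Euclidean one.
  A maximum is rendered by \<open>Greatest\<close>; that the maxima exist is proved below.
\<close>

definition is_dataset :: "real ^ 'p ^ 'n \<Rightarrow> real ^ 'n \<Rightarrow> bool" where
  "is_dataset X y \<longleftrightarrow> (\<forall>i. y $ i \<in> {-1, 1})"

definition is_norm :: "('a::real_vector \<Rightarrow> real) \<Rightarrow> bool" where
  "is_norm N \<longleftrightarrow>
     (\<forall>x. 0 \<le> N x) \<and>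
     (\<forall>x. N x = 0 \<longleftrightarrow> x = 0) \<and>
     (\<forall>c x. N (c *\<^sub>R x) = \<bar>c\<bar> * N x) \<and>
     (\<forall>x y. N (x + y) \<le> N x + N y)"

definition separable :: "real ^ 'p ^ 'n \<Rightarrow> real ^ 'n \<Rightarrow> bool" where
  "separable X y \<longleftrightarrow> (\<exists>\<beta>. \<forall>i. y $ i * (\<beta> \<bullet> X $ i) > 0)"

definition margin :: "real ^ 'p ^ 'n \<Rightarrow> real ^ 'n \<Rightarrow> real ^ 'p \<Rightarrow> real" where
  "margin X y \<beta> = (MIN i. y $ i * (\<beta> \<bullet> X $ i))"

definition norm_dot_inf :: "(real ^ 'p \<Rightarrow> real) \<Rightarrow> real ^ 'p ^ 'n \<Rightarrow> real" where
  "norm_dot_inf N A = (GREATEST r. \<exists>\<beta>. N \<beta> \<le> 1 \<and> r = infnorm (A *v \<beta>))"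

definition DegSEP :: "(real ^ 'p \<Rightarrow> real) \<Rightarrow> real ^ 'p ^ 'n \<Rightarrow> real ^ 'n \<Rightarrow> real" where
  "DegSEP N X y = (GREATEST r. \<exists>\<beta>. N \<beta> \<le> 1 \<and> r = margin X y \<beta>)"

definition PertNSEP :: "(real ^ 'p \<Rightarrow> real) \<Rightarrow> real ^ 'p ^ 'n \<Rightarrow> real ^ 'n \<Rightarrow> real" where
  "PertNSEP N X y = Inf {norm_dot_inf N D | D. \<not> separable (X + D) y}"


subsection \<open>Existence of the maxima, and of the infimum\<close>

lemma is_norm_continuous:
  fixes N :: "'a::euclidean_space \<Rightarrow> real"
  assumes "is_norm N"
  shows "continuous_on S N"
proof -
  have "convex_on UNIV N"
  proof (rule convex_onI)
    fix t :: real and x y :: 'a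
    assume t: "0 < t" "t < 1"
    have "N ((1 - t) *\<^sub>R x + t *\<^sub>R y) \<le> N ((1 - t) *\<^sub>R x) + N (t *\<^sub>R y)"
      using assms unfolding is_norm_def by blast
    also have "\<dots> = (1 - t) * N x + t * N y"
      using assms t by (auto simp: is_norm_def)
    finally show "N ((1 - t) *\<^sub>R x + t *\<^sub>R y) \<le> (1 - t) * N x + t * N y" .
  qed auto
  then have "continuous_on UNIV N"
    by (intro convex_on_continuous) auto
  then show ?thesis
    by (rule continuous_on_subset) auto
qed

lemma is_norm_compact_ball:
  fixes N :: "'a::euclidean_space \<Rightarrow> real"
  assumes N: "is_norm N"
  shows "compact {x. N x \<le> 1}"
proof -
  have "closed {x. N x \<le> 1}"
    by (intro closed_Collect_le is_norm_continuous[OF N] continuous_on_const)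
  moreover have "bounded {x. N x \<le> 1}"
  proof -
    have "sphere (0::'a) 1 \<noteq> {}" by simp
    then obtain u where u: "u \<in> sphere (0::'a) 1" "\<forall>x\<in>sphere 0 1. N u \<le> N x"
      using continuous_attains_inf[OF compact_sphere _ is_norm_continuous[OF N]] by blast
    have "u \<noteq> 0" using u(1) by auto
    then have pos: "N u > 0"
      using N by (metis is_norm_def less_eq_real_def)
    have "norm x \<le> 1 / N u" if "N x \<le> 1" for x
    proof (cases "x = 0")
      case False
      then have "N u \<le> N ((1 / norm x) *\<^sub>R x)"
        using u(2) by simp
      also have "\<dots> = (1 / norm x) * N x"
        using N unfolding is_norm_def by (metis abs_of_nonneg divide_nonneg_nonneg norm_ge_zero zero_le_one)
      also have "\<dots> \<le> 1 / norm x"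
        using that by (simp add: divide_right_mono)
      finally show ?thesis
        using False pos by (simp add: field_simps)
    qed (use pos in auto)
    then show ?thesis
      by (auto intro: boundedI)
  qed
  ultimately show ?thesis
    by (simp add: compact_eq_bounded_closed)
qed

lemma Greatest_attained:
  fixes N :: "'a::euclidean_space \<Rightarrow> real" and f :: "'a \<Rightarrow> real"
  assumes N: "is_norm N" and f: "continuous_on UNIV f"
  shows "\<exists>\<beta>. N \<beta> \<le> 1 \<and> (GREATEST r. \<exists>\<beta>. N \<beta> \<le> 1 \<and> r = f \<beta>) = f \<beta> \<and> (\<forall>\<gamma>. N \<gamma> \<le> 1 \<longrightarrow> f \<gamma> \<le> f \<beta>)"
proof -
  have "N 0 = 0" using N unfolding is_norm_def by blast
  then have "N 0 \<le> 1" by simp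
  then have "{x. N x \<le> 1} \<noteq> {}" by blast
  then obtain b where b: "N b \<le> 1" "\<forall>\<gamma>. N \<gamma> \<le> 1 \<longrightarrow> f \<gamma> \<le> f b"
    using continuous_attains_sup[OF is_norm_compact_ball[OF N] _ continuous_on_subset[OF f subset_UNIV]]
    by auto
  then have "(GREATEST r. \<exists>\<beta>. N \<beta> \<le> 1 \<and> r = f \<beta>) = f b"
    by (intro Greatest_equality) auto
  with b show ?thesis by blast
qed

lemma continuous_on_margin: "continuous_on S (margin X y)"
proof -
  have eq: "margin X y = (\<lambda>\<beta>. MIN i\<in>UNIV. y $ i * (\<beta> \<bullet> X $ i))"
    by (simp add: margin_def fun_eq_iff)
  have "continuous_on S (\<lambda>\<beta>. MIN i\<in>I. y $ i * (\<beta> \<bullet> X $ i))"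
    if "finite I" "I \<noteq> {}" for I
    using that
    by (induction I rule: finite_ne_induct) (auto intro!: continuous_intros)
  then show ?thesis unfolding eq by simp
qed

lemma DegSEP_attained:
  assumes "is_norm N"
  shows "\<exists>\<beta>. N \<beta> \<le> 1 \<and> DegSEP N X y = margin X y \<beta> \<and>
           (\<forall>\<gamma>. N \<gamma> \<le> 1 \<longrightarrow> margin X y \<gamma> \<le> margin X y \<beta>)"
  unfolding DegSEP_def by (rule Greatest_attained[OF assms continuous_on_margin])

lemma norm_dot_inf_attained:
  assumes "is_norm N"
  shows "\<exists>\<beta>. N \<beta> \<le> 1 \<and> norm_dot_inf N A = infnorm (A *v \<beta>) \<and>
           (\<forall>\<gamma>. N \<gamma> \<le> 1 \<longrightarrow> infnorm (A *v \<gamma>) \<le> infnorm (A *v \<beta>))"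
  unfolding norm_dot_inf_def
  by (rule Greatest_attained[OF assms])
     (intro continuous_on_infnorm linear_continuous_on matrix_vector_mul_bounded_linear)

lemma PertNSEP_set_nonempty: "{norm_dot_inf N D | D. \<not> separable (X + D) y} \<noteq> {}"
proof -
  have "\<not> separable (X + (- X)) y" by (simp add: separable_def)
  then show ?thesis by blast
qed

lemma PertNSEP_set_bdd_below:
  assumes "is_norm N"
  shows "bdd_below {norm_dot_inf N D | D. \<not> separable (X + D) y}"
proof (rule bdd_belowI)
  fix r assume "r \<in> {norm_dot_inf N D | D. \<not> separable (X + D) y}"
  then obtain D where "\<not> separable (X + D) y" "r = norm_dot_inf N D" by blast
  with norm_dot_inf_attained[OF assms, of D] show "0 \<le> r"
    by (auto simp: infnorm_pos_le)
qed

end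

theory Submission
  imports Defs
begin

text \<open>
  A non-separable perturbation \<open>X + D\<close> fails on the best \<open>\<beta>\<close> of \<open>X\<close> at some \<open>i\<close>, so \<open>D\<close> must
  have moved the \<open>i\<close>-th margin of \<open>\<beta>\<close> by at least \<open>DegSEP\<close>. Conversely, separating the attainable
  margin vectors from the orthant of vectors with all entries above \<open>d = DegSEP\<close> gives convex
  weights \<open>\<lambda>\<close> such that \<open>w = (\<Sum>i. \<lambda>\<^sub>i y\<^sub>i x\<^sub>i)\<close> has dual norm at most \<open>d\<close>. Subtracting \<open>y\<^sub>i w\<close> from
  row \<open>i\<close> makes the \<open>\<lambda>\<close>-combination of the signed rows vanish, so the result is non-separable.
\<close>

lemma less_margin_iff: "c < margin X y \<beta> \<longleftrightarrow> (\<forall>i. c < y $ i * (\<beta> \<bullet> X $ i))"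
  unfolding margin_def by (subst Min_gr_iff) auto

lemma margin_le: "margin X y \<beta> \<le> y $ i * (\<beta> \<bullet> X $ i)"
  unfolding margin_def by (intro Min_le) auto

lemma is_norm_convex_ball:
  assumes "is_norm N"
  shows "convex {x. N x \<le> 1}"
proof (rule convexI)
  fix u v :: real and x y
  assume *: "x \<in> {x. N x \<le> 1}" "y \<in> {x. N x \<le> 1}" "0 \<le> u" "0 \<le> v" "u + v = 1"
  have "N (u *\<^sub>R x + v *\<^sub>R y) \<le> N (u *\<^sub>R x) + N (v *\<^sub>R y)"
    using assms unfolding is_norm_def by blast
  also have "\<dots> = u * N x + v * N y"
    using assms * by (auto simp: is_norm_def)
  also have "\<dots> \<le> 1"
    using * by (intro convex_bound_le) auto
  finally show "u *\<^sub>R x + v *\<^sub>R y \<in> {x. N x \<le> 1}" by simp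
qed

lemma infnorm_cart_le:
  fixes x :: "real ^ 'n"
  assumes "\<And>i. \<bar>x $ i\<bar> \<le> c"
  shows "infnorm x \<le> c"
  unfolding infnorm_cart by (rule cSup_least) (use assms in auto)

text \<open>A hyperplane with normal \<open>a\<close> separates \<open>S\<close> from the open
  orthant \<open>T\<close> with corner (d, ..., d). Since \<open>T\<close> is unbounded along every
  positive axis, \<open>a\<close> has no negative entry, so its sum \<open>s\<close> is positive and
  \<open>a\<close> divided by \<open>s\<close> gives the weights.\<close>

lemma convex_orthant_weights:
  fixes S :: "(real ^ 'n) set"
  assumes S: "convex S" "S \<noteq> {}"
    and ex: "\<And>x. x \<in> S \<Longrightarrow> \<exists>i. x $ i \<le> d"
  obtains l :: "real ^ 'n"
  where "\<And>i. 0 \<le> l $ i" "(\<Sum>i\<in>UNIV. l $ i) = 1" "\<And>x. x \<in> S \<Longrightarrow> l \<bullet> x \<le> d"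
proof -
  define T where "T = {v :: real ^ 'n. \<forall>i. d < v $ i}"
  have T_eq: "T = (\<Inter>i. {v. axis i 1 \<bullet> v > d})"
    by (auto simp: T_def inner_axis')
  have "convex T"
    unfolding T_eq by (intro convex_INT convex_halfspace_gt)
  moreover have "(\<chi> i. d + 1) \<in> T" by (simp add: T_def)
  moreover have "S \<inter> T = {}"
    using ex by (fastforce simp: T_def simp flip: not_le)
  ultimately obtain a b where a: "a \<noteq> 0" and aS: "\<forall>x\<in>S. a \<bullet> x \<le> b" and aT: "\<forall>x\<in>T. b \<le> a \<bullet> x"
    using separating_hyperplane_sets[OF S(1) _ S(2), of T] by auto
  define s where "s = (\<Sum>i\<in>UNIV. a $ i)"
  have a_const: "a \<bullet> (\<chi> i. c) = c * s" for c
    by (simp add: inner_vec_def s_def sum_distrib_left mult.commute)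
  have nonneg: "0 \<le> a $ i" for i
  proof (rule ccontr)
    assume neg: "\<not> 0 \<le> a $ i"
    \<comment> \<open>Moving by \<open>t\<close> along axis \<open>i\<close> stays in
      \<open>T\<close> but brings the value of \<open>a\<close> down to at most
      \<open>b - 1\<close>.\<close>
    define t where "t = (\<bar>(d + 1) * s - b\<bar> + 1) / (- a $ i)"
    have "0 \<le> t"
      using neg unfolding t_def by (intro divide_nonneg_nonneg) auto
    then have "(\<chi> i. d + 1) + t *\<^sub>R axis i 1 \<in> T"
      by (auto simp: T_def axis_def)
    then have "b \<le> a \<bullet> ((\<chi> i. d + 1) + t *\<^sub>R axis i 1)"
      using aT by blast
    also have "\<dots> = (d + 1) * s + t * a $ i"
      by (simp add: inner_add_right a_const inner_axis)
    also have "t * a $ i = - (\<bar>(d + 1) * s - b\<bar> + 1)"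
      using neg by (simp add: t_def)
    finally show False by linarith
  qed
  obtain k where "a $ k \<noteq> 0"
    using a by (auto simp: vec_eq_iff)
  then have "0 < s"
    unfolding s_def using nonneg by (intro sum_pos2[of _ k]) (auto simp: less_le)
  \<comment> \<open>The corner itself lies outside the open orthant, so it is approached by constant
    vectors of \<open>T\<close>.\<close>
  have "b \<le> d * s"
  proof (rule field_le_epsilon)
    fix e :: real assume "0 < e"
    then have "(\<chi> i. d + e / s) \<in> T"
      using \<open>0 < s\<close> by (simp add: T_def)
    then have "b \<le> a \<bullet> (\<chi> i. d + e / s)"
      using aT by blast
    also have "\<dots> = d * s + e"
      unfolding a_const using \<open>0 < s\<close> by (simp add: field_simps)
    finally show "b \<le> d * s + e" .
  qed
  show thesis
  proof
    show "0 \<le> ((1 / s) *\<^sub>R a) $ i" for i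
      using nonneg \<open>0 < s\<close> by simp
    show "(\<Sum>i\<in>UNIV. ((1 / s) *\<^sub>R a) $ i) = 1"
      using \<open>0 < s\<close> by (simp add: s_def flip: sum_divide_distrib)
    show "((1 / s) *\<^sub>R a) \<bullet> x \<le> d" if "x \<in> S" for x
      using aS that \<open>b \<le> d * s\<close> \<open>0 < s\<close> by (force simp: field_simps)
  qed
qed

lemma DegSEP_le_norm_dot_inf:
  assumes N: "is_norm N" and y: "is_dataset X y" and nsep: "\<not> separable (X + D) y"
  shows "DegSEP N X y \<le> norm_dot_inf N D"
proof -
  obtain \<beta> where \<beta>: "N \<beta> \<le> 1" "DegSEP N X y = margin X y \<beta>"
    using DegSEP_attained[OF N] by blast
  obtain i where i: "y $ i * (\<beta> \<bullet> (X + D) $ i) \<le> 0"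
    using nsep unfolding separable_def by (meson not_le)
  have "y $ i = - 1 \<or> y $ i = 1"
    using y by (auto simp: is_dataset_def)
  \<comment> \<open>The left side is at most \<open>- y $ i * (\<beta> \<bullet> D $ i)\<close>, and
    the sign disappears in the absolute value.\<close>
  then have "y $ i * (\<beta> \<bullet> X $ i) \<le> \<bar>(D *v \<beta>) $ i\<bar>"
    using i by (auto simp: inner_add_right matrix_vector_mul_component inner_commute)
  also have "\<dots> \<le> infnorm (D *v \<beta>)"
    by (rule component_le_infnorm_cart)
  also have "\<dots> \<le> norm_dot_inf N D"
    using norm_dot_inf_attained[OF N, of D] \<beta>(1) by auto
  finally show ?thesis
    using margin_le[of X y \<beta> i] \<beta>(2) by linarith
qed

text \<open>Together with \<open>DegSEP_le_norm_dot_inf\<close>, this shows that the infimum in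
  \<open>PertNSEP\<close> is attained.\<close>

lemma ex_nonseparable_perturbation:
  fixes X :: "real ^ 'p ^ 'n" and N :: "real ^ 'p \<Rightarrow> real"
  assumes N: "is_norm N" and y: "is_dataset X y"
  shows "\<exists>D. \<not> separable (X + D) y \<and> norm_dot_inf N D \<le> DegSEP N X y"
proof -
  define d where "d = DegSEP N X y"
  define f where "f = (\<lambda>\<beta>. \<chi> i. y $ i * (\<beta> \<bullet> X $ i))"
  have "linear f"
    by (rule linearI) (auto simp: f_def vec_eq_iff inner_add_left algebra_simps)
  then have "convex (f ` {\<beta>. N \<beta> \<le> 1})"
    by (rule convex_linear_image[OF _ is_norm_convex_ball[OF N]])
  moreover have "f ` {\<beta>. N \<beta> \<le> 1} \<noteq> {}"
    using DegSEP_attained[OF N] by blast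
  \<comment> \<open>By maximality of \<open>d\<close>, no \<beta> in the unit ball has all its
    signed margins above \<open>d\<close>.\<close>
  moreover have "\<exists>i. v $ i \<le> d" if "v \<in> f ` {\<beta>. N \<beta> \<le> 1}" for v
  proof -
    obtain \<beta> where "N \<beta> \<le> 1" and v: "v = f \<beta>"
      using \<open>v \<in> _\<close> by blast
    then have "\<not> d < margin X y \<beta>"
      using DegSEP_attained[OF N, of X y] by (auto simp: d_def not_less)
    then show ?thesis
      by (auto simp: less_margin_iff v f_def not_less)
  qed
  ultimately obtain l where l: "\<And>i. 0 \<le> l $ i" and sum_l: "(\<Sum>i\<in>UNIV. l $ i) = 1"
    and le: "\<And>v. v \<in> f ` {\<beta>. N \<beta> \<le> 1} \<Longrightarrow> l \<bullet> v \<le> d"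
    using convex_orthant_weights by metis
  define w where "w = (\<Sum>i\<in>UNIV. (l $ i * y $ i) *\<^sub>R X $ i)"
  have w: "\<beta> \<bullet> w = l \<bullet> f \<beta>" for \<beta>
    by (simp add: w_def f_def inner_vec_def[of l] inner_sum_right mult.assoc)
  \<comment> \<open>As each label squares to 1, this lowers every signed margin of \<gamma> by the
    same amount \<open>\<gamma> \<bullet> w\<close>, which is the \<open>l\<close>-weighted mean of
    those margins.\<close>
  define D :: "real ^ 'p ^ 'n" where "D = (\<chi> i. - y $ i *\<^sub>R w)"
  have yy: "y $ i * y $ i = 1" for i
  proof -
    have "y $ i \<in> {-1, 1}" using y by (simp add: is_dataset_def)
    then show ?thesis by auto
  qed
  have "\<not> separable (X + D) y"
  proof
    assume "separable (X + D) y"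
    then obtain \<gamma> where \<gamma>: "\<And>i. 0 < y $ i * (\<gamma> \<bullet> (X + D) $ i)"
      unfolding separable_def by blast
    have "y $ i * (\<gamma> \<bullet> (X + D) $ i) = f \<gamma> $ i - (y $ i * y $ i) * (\<gamma> \<bullet> w)" for i
      by (simp add: D_def f_def inner_add_right inner_diff_right algebra_simps)
    then have eq: "y $ i * (\<gamma> \<bullet> (X + D) $ i) = f \<gamma> $ i - \<gamma> \<bullet> w" for i
      by (simp add: yy)
    \<comment> \<open>One positive weight makes the weighted sum of the positive margins strictly
      positive, although it must vanish.\<close>
    obtain k where "l $ k \<noteq> 0"
      using sum_l by (metis sum.neutral zero_neq_one)
    then have "0 < (\<Sum>i\<in>UNIV. l $ i * (f \<gamma> $ i - \<gamma> \<bullet> w))"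
      using l \<gamma> unfolding eq by (intro sum_pos2[of _ k]) (auto simp: less_le)
    also have "\<dots> = l \<bullet> f \<gamma> - (\<Sum>i\<in>UNIV. l $ i) * (\<gamma> \<bullet> w)"
      by (simp add: inner_vec_def[of l] right_diff_distrib sum_subtractf sum_distrib_right)
    finally show False
      by (simp add: sum_l w)
  qed
  moreover have "norm_dot_inf N D \<le> d"
  proof -
    obtain \<beta> where \<beta>: "N \<beta> \<le> 1" "norm_dot_inf N D = infnorm (D *v \<beta>)"
      using norm_dot_inf_attained[OF N] by blast
    \<comment> \<open>The weights bound \<open>\<beta> \<bullet> w\<close> only from above; symmetry
      of the unit ball turns this into a bound on its absolute value.\<close>
    have "N (- \<beta>) = \<bar>- 1\<bar> * N \<beta>"
      using N unfolding is_norm_def by (metis scaleR_minus1_left)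
    then have "N (- \<beta>) \<le> 1"
      using \<beta>(1) by simp
    then have "\<beta> \<bullet> w \<le> d" "- \<beta> \<bullet> w \<le> d"
      unfolding w using \<beta>(1) le by blast+
    moreover have "\<bar>y $ i\<bar> = 1" for i
      using yy[of i] by (simp add: abs_square_eq_1 flip: power2_eq_square)
    ultimately have "\<bar>(D *v \<beta>) $ i\<bar> \<le> d" for i
      by (auto simp: D_def matrix_vector_mul_component inner_commute abs_mult)
    then show ?thesis
      unfolding \<beta>(2) by (rule infnorm_cart_le)
  qed
  ultimately show ?thesis
    unfolding d_def by blast
qed

theorem proposition2p5:
  fixes X :: "real ^ 'p ^ 'n" and y :: "real ^ 'n" and N :: "real ^ 'p \<Rightarrow> real"
  assumes "is_norm N" and "is_dataset X y"
  shows "DegSEP N X y = PertNSEP N X y"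
proof (rule antisym)
  show "DegSEP N X y \<le> PertNSEP N X y"
    unfolding PertNSEP_def
    by (rule cInf_greatest[OF PertNSEP_set_nonempty])
       (use DegSEP_le_norm_dot_inf[OF assms] in blast)
  obtain D where D: "\<not> separable (X + D) y" "norm_dot_inf N D \<le> DegSEP N X y"
    using ex_nonseparable_perturbation[OF assms] by blast
  have "PertNSEP N X y \<le> norm_dot_inf N D"
    unfolding PertNSEP_def
    by (rule cInf_lower[OF _ PertNSEP_set_bdd_below[OF assms(1)]]) (use D(1) in blast)
  with D(2) show "PertNSEP N X y \<le> DegSEP N X y" by linarith
qed

end
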